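(* Let $1\le p\le\infty$ and let $u,\psi$ be entire functions on $\mathbb{C}$ such that the weighted composition operator $W_{(u,\psi)}$ is bounded on the Fock space $\mathcal{F}_p$. (i) If $\psi(z)=az+b$ with $a,b\in\mathbb{C}$, $|a|=1$ and $|u(0)|<e^{-\frac{|b|^2}{2}}$, then $W_{(u,\psi)}$ is uniformly mean ergodic on $\mathcal{F}_p$, and $$\lim_{n\to\infty}\Big\|\frac1n\sum_{k=0}^nW_{(u,\psi)}^k\Big\|=0$$ in operator norm. (ii) If $\psi(z)=az$ with $|a|=1$ and both $u(0)$ and $a$ are roots of unity, then $W_{(u,\psi)}$ is uniformly mean ergodic on $\mathcal{F}_p$.
   Context: For $1\le p<\infty$, the Fock space $\mathcal{F}_p$ consists of all entire functions $f$ on $\mathbb{C}$ with $\|f\|_p=\Big(\frac{p}{2\pi}\int_{\mathbb{C}}|f(z)|^pe^{-\frac{p|z|^2}{2}}dA(z)\Big)^{1/p}<\infty$, where $dA$ is Lebesgue area measure; $\mathcal{F}_\infty$ consists of all entire $f$ with $\|f\|_\infty=\sup_{z\in\mathbb{C}}|f(z)|e^{-\frac{|z|^2}{2}}<\infty$. For entire $u,\psi$, the weighted composition operator is $W_{(u,\psi)}f=u\cdot (f\circ\psi)$. A bounded operator $T$ on a Banach space $X$ is uniformly mean ergodic if there is a bounded operator $P$ on $X$ with $\lim_{n\to\infty}\big\|\frac1n\sum_{m=1}^nT^m-P\big\|=0$ in operator norm. $T^0$ is the identity operator. *)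

theory Defs
  imports "HOL-Analysis.Analysis"
begin

text \<open>
  The exponent ranges over the extended nonnegative reals, so that the case of an infinite
  exponent is included. The space depends on the term \<open>p\<close>, so it is a carrier set of functions
  rather than a type.
\<close>

definition fock_space :: "ennreal \<Rightarrow> (complex \<Rightarrow> complex) set" where
  "fock_space p =
     {f. f holomorphic_on UNIV \<and>
         (if p = \<infinity>
          then bdd_above (range (\<lambda>z. norm (f z) * exp (- (norm z)\<^sup>2 / 2)))
          else integrable lborel
                 (\<lambda>z. norm (f z) powr enn2real p * exp (- (enn2real p * (norm z)\<^sup>2) / 2)))}"

text \<open>Real-valued, hence meaningful only for members of \<open>fock_space p\<close>.\<close>

definition fock_norm :: "ennreal \<Rightarrow> (complex \<Rightarrow> complex) \<Rightarrow> real" where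
  "fock_norm p f =
     (if p = \<infinity>
      then (SUP z. norm (f z) * exp (- (norm z)\<^sup>2 / 2))
      else (enn2real p / (2 * pi) *
             (LINT z|lborel. norm (f z) powr enn2real p * exp (- (enn2real p * (norm z)\<^sup>2) / 2)))
           powr (1 / enn2real p))"

type_synonym fun_operator = "(complex \<Rightarrow> complex) \<Rightarrow> (complex \<Rightarrow> complex)"

definition fock_bounded_op :: "ennreal \<Rightarrow> fun_operator \<Rightarrow> bool" where
  "fock_bounded_op p T \<longleftrightarrow>
     (\<forall>f\<in>fock_space p. T f \<in> fock_space p) \<and>
     (\<forall>f\<in>fock_space p. \<forall>g\<in>fock_space p. T (\<lambda>z. f z + g z) = (\<lambda>z. T f z + T g z)) \<and>
     (\<forall>c. \<forall>f\<in>fock_space p. T (\<lambda>z. c * f z) = (\<lambda>z. c * T f z)) \<and>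
     (\<exists>C. \<forall>f\<in>fock_space p. fock_norm p (T f) \<le> C * fock_norm p f)"

text \<open>
  As for \<^const>\<open>onorm\<close>, the zero function contributes \<open>0 / 0 = 0\<close>. Only meaningful for
  bounded operators, for which the supremum is finite.
\<close>

definition fock_onorm :: "ennreal \<Rightarrow> fun_operator \<Rightarrow> real" where
  "fock_onorm p T = (SUP f\<in>fock_space p. fock_norm p (T f) / fock_norm p f)"

definition weighted_comp :: "(complex \<Rightarrow> complex) \<Rightarrow> (complex \<Rightarrow> complex) \<Rightarrow> fun_operator" where
  "weighted_comp u \<psi> f = (\<lambda>z. u z * f (\<psi> z))"

definition uniformly_mean_ergodic :: "ennreal \<Rightarrow> fun_operator \<Rightarrow> bool" where
  "uniformly_mean_ergodic p T \<longleftrightarrow>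
     fock_bounded_op p T \<and>
     (\<exists>P. fock_bounded_op p P \<and>
        (\<lambda>n. fock_onorm p (\<lambda>f z. (1 / of_nat n) * (\<Sum>m=1..n. (T ^^ m) f z) - P f z))
          \<longlonglongrightarrow> 0)"

definition root_of_unity :: "complex \<Rightarrow> bool" where
  "root_of_unity w \<longleftrightarrow> (\<exists>k::nat. k \<ge> 1 \<and> w ^ k = 1)"

end

theory Submission
  imports Defs "HOL-Complex_Analysis.Complex_Analysis"
begin

text \<open>
  Put \<open>M f z = norm (f z) * exp (- (norm z)\<^sup>2 / 2)\<close> and \<open>\<psi> z = a * z + b\<close> with \<open>norm a = 1\<close>. Testing
  boundedness of \<open>W\<close> on normalised reproducing kernels shows that the entire function
  \<open>u z * exp (a * cnj b * z)\<close> is bounded, hence constant by Liouville. Consequently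
  \<open>M (W f) z = r * M f (\<psi> z)\<close> with \<open>r = norm (u 0) * exp ((norm b)\<^sup>2 / 2)\<close>; as \<open>\<psi>\<close> is a planar
  isometry, \<open>W\<close> is \<open>r\<close> times an isometry of every Fock space. In (i) we have \<open>r < 1\<close>, so the sums of
  the iterates stay bounded and their means tend to \<open>0\<close>; in (ii) \<open>W\<close> is periodic, and the
  means converge to the average over one period.
\<close>

section \<open>Planar Lebesgue measure and mean values\<close>

lemma nn_integral_lborel_translate:
  fixes f :: "'a::euclidean_space \<Rightarrow> ennreal"
  assumes [measurable]: "f \<in> borel_measurable borel"
  shows "(\<integral>\<^sup>+x. f (c + x) \<partial>lborel) = (\<integral>\<^sup>+x. f x \<partial>lborel)"
proof -
  have "(\<integral>\<^sup>+x. f x \<partial>lborel) = (\<integral>\<^sup>+x. f x \<partial>distr lborel borel ((+) c))"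
    by (simp add: lborel_distr_plus)
  then show ?thesis
    by (simp add: nn_integral_distr)
qed

text \<open>
  Uniqueness of Haar measure, specialised: the double integral of
  \<open>f x * indicator (ball 0 1) (x - a * y)\<close> is computed in both orders, and the volume of the
  disc cancels.
\<close>

lemma nn_integral_lborel_rotate:
  fixes f :: "complex \<Rightarrow> ennreal"
  assumes [measurable]: "f \<in> borel_measurable borel" and a: "norm a = 1"
  shows "(\<integral>\<^sup>+z. f (a * z) \<partial>lborel) = (\<integral>\<^sup>+z. f z \<partial>lborel)"
proof -
  define g :: "complex \<Rightarrow> ennreal" where "g = indicator (ball 0 1)"
  have [measurable]: "g \<in> borel_measurable borel"
    unfolding g_def by (intro borel_measurable_indicator) auto
  define V where "V = (\<integral>\<^sup>+z. g z \<partial>lborel)"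
  have V: "V = emeasure lborel (ball (0::complex) 1)"
    unfolding V_def g_def by simp
  have V0: "V \<noteq> 0" and Vtop: "V \<noteq> \<infinity>"
    unfolding V using emeasure_lborel_ball_finite[of "0::complex" 1]
    by (auto simp: emeasure_ball unit_ball_vol_2)
  have a0: "a \<noteq> 0" using a by auto
  \<comment> \<open>\<open>x - a * y\<close> is \<open>- a\<close> times a translate of
    \<open>y\<close>, and the disc is invariant under factors of modulus 1, so translation
    invariance alone gives the value.\<close>
  have gy: "(\<integral>\<^sup>+y. g (x - a * y) \<partial>lborel) = V" for x
  proof -
    have "g (x - a * y) = g (- (x / a) + y)" for y
    proof -
      have "x - a * y = - a * (- (x / a) + y)"
        using a0 by (simp add: field_simps)
      then have "norm (x - a * y) = norm (- (x / a) + y)"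
        by (metis a mult_1 norm_minus_cancel norm_mult)
      then show ?thesis
        by (simp add: g_def indicator_def)
    qed
    then show ?thesis
      using nn_integral_lborel_translate[of g "- (x / a)"] by (simp add: V_def)
  qed
  have "(\<integral>\<^sup>+x. f x \<partial>lborel) * V = (\<integral>\<^sup>+x. (\<integral>\<^sup>+y. f x * g (x - a * y) \<partial>lborel) \<partial>lborel)"
    by (simp add: nn_integral_cmult gy nn_integral_multc)
  also have "\<dots> = (\<integral>\<^sup>+y. (\<integral>\<^sup>+x. f x * g (x - a * y) \<partial>lborel) \<partial>lborel)"
    by (rule lborel_pair.Fubini') simp
  also have "\<dots> = (\<integral>\<^sup>+y. (\<integral>\<^sup>+x. f (a * y + x) * g x \<partial>lborel) \<partial>lborel)"
  proof (rule nn_integral_cong)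
    fix y :: complex
    show "(\<integral>\<^sup>+x. f x * g (x - a * y) \<partial>lborel) = (\<integral>\<^sup>+x. f (a * y + x) * g x \<partial>lborel)"
      using nn_integral_lborel_translate[of "\<lambda>x. f x * g (x - a * y)" "a * y"] by simp
  qed
  also have "\<dots> = (\<integral>\<^sup>+x. (\<integral>\<^sup>+y. f (a * y + x) * g x \<partial>lborel) \<partial>lborel)"
    by (rule lborel_pair.Fubini') simp
  also have "\<dots> = (\<integral>\<^sup>+x. (\<integral>\<^sup>+y. f (a * y) \<partial>lborel) * g x \<partial>lborel)"
  proof (rule nn_integral_cong)
    fix x :: complex
    have "(\<integral>\<^sup>+y. f (a * y + x) \<partial>lborel) = (\<integral>\<^sup>+y. f (a * y) \<partial>lborel)"
      using nn_integral_lborel_translate[of "\<lambda>y. f (a * y)" "x / a"] a0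
      by (simp add: distrib_left add.commute)
    then show "(\<integral>\<^sup>+y. f (a * y + x) * g x \<partial>lborel) = (\<integral>\<^sup>+y. f (a * y) \<partial>lborel) * g x"
      by (simp add: nn_integral_multc)
  qed
  also have "\<dots> = (\<integral>\<^sup>+y. f (a * y) \<partial>lborel) * V"
    by (simp add: nn_integral_cmult V_def)
  finally have "V * (\<integral>\<^sup>+x. f x \<partial>lborel) = V * (\<integral>\<^sup>+y. f (a * y) \<partial>lborel)"
    by (simp only: mult.commute)
  then show ?thesis
    using V0 Vtop by (simp add: ennreal_mult_cancel_left)
qed

lemma nn_integral_lborel_isometry:
  fixes f :: "complex \<Rightarrow> ennreal"
  assumes [measurable]: "f \<in> borel_measurable borel" and a: "norm a = 1"
  shows "(\<integral>\<^sup>+z. f (a * z + b) \<partial>lborel) = (\<integral>\<^sup>+z. f z \<partial>lborel)"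
  using nn_integral_lborel_rotate[of "\<lambda>z. f (b + z)" a] nn_integral_lborel_translate[of f b] a
  by (simp add: add.commute)

text \<open>Cauchy's formula on the unit circle for \<open>\<lambda>w. v (\<zeta> + w * z)\<close>
  at \<open>w = 0\<close>, followed by the triangle inequality. The mean runs over rotations of a
  fixed \<open>z\<close>, so it can afterwards be integrated over all \<open>z\<close> in a
  disc.\<close>

lemma norm_le_circle_mean:
  assumes v: "v holomorphic_on UNIV"
  shows "ennreal (norm (v \<zeta>)) \<le>
    (\<integral>\<^sup>+t. ennreal (norm (v (\<zeta> + exp (2 * of_real pi * \<i> * of_real t) * z))) * indicator {0..1} t \<partial>lborel)"
proof -
  define h where "h = (\<lambda>t. v (\<zeta> + exp (2 * of_real pi * \<i> * of_real t) * z))"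
  have contv: "continuous_on A v" for A
    using holomorphic_on_imp_continuous_on[OF v] continuous_on_subset by blast
  have conth: "continuous_on A h" for A
    unfolding h_def by (intro continuous_on_compose2[OF contv[of UNIV]] continuous_intros) auto
  have hol: "(\<lambda>w. v (\<zeta> + w * z)) holomorphic_on cball 0 1"
    by (intro holomorphic_on_compose_gen[OF _ v, unfolded o_def] holomorphic_intros) auto
  have cauchy: "((\<lambda>w. v (\<zeta> + w * z) / (w - 0)) has_contour_integral (2 * of_real pi * \<i> * v (\<zeta> + 0 * z)))
      (circlepath 0 1)"
    by (rule Cauchy_integral_circlepath_simple[OF hol]) auto
  \<comment> \<open>The exponential in the derivative of the path cancels the denominator.\<close>
  have "v (\<zeta> + circlepath 0 1 t * z) / (circlepath 0 1 t - 0) *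
        vector_derivative (circlepath 0 1) (at t within {0..1}) = (2 * of_real pi * \<i>) * h t"
    if "t \<in> {0..1}" for t
  proof -
    have "vector_derivative (circlepath 0 1) (at t within {0..1})
        = 2 * of_real pi * \<i> * exp (2 * of_real pi * \<i> * of_real t)"
      using that by (subst vector_derivative_circlepath01) auto
    then show ?thesis
      by (simp add: circlepath h_def)
  qed
  then have "((\<lambda>t. (2 * of_real pi * \<i>) * h t) has_integral (2 * of_real pi * \<i>) * v (\<zeta> + 0 * z)) {0..1}"
    using cauchy unfolding has_contour_integral_def by (rule has_integral_eq)
  then have "((\<lambda>t. (2 * of_real pi * \<i>) * h t) has_integral (2 * of_real pi * \<i>) * v \<zeta>) {0..1}"
    by simp
  from has_integral_mult_right[OF this, of "inverse (2 * of_real pi * \<i>)"]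
  have hi: "(h has_integral v \<zeta>) {0..1}"
    by (simp add: field_simps)
  have ci: "(\<lambda>t. norm (h t)) integrable_on {0..1}"
    by (intro integrable_continuous_interval continuous_intros conth)
  have "norm (v \<zeta>) \<le> integral {0..1} (\<lambda>t. norm (h t))"
    using integral_norm_bound_integral[OF has_integral_integrable[OF hi] ci] integral_unique[OF hi] by simp
  moreover have "(\<integral>\<^sup>+t. ennreal (norm (h t)) * indicator {0..1} t \<partial>lborel)
      = ennreal (integral {0..1} (\<lambda>t. norm (h t)))"
  proof (rule nn_integral_has_integral_lebesgue')
    show "((\<lambda>t. norm (h t)) has_integral integral {0..1} (\<lambda>t. norm (h t))) {0..1}"
      using ci by (rule integrable_integral)
  qed auto
  ultimately show ?thesis
    unfolding h_def by (simp add: ennreal_leI)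
qed

text \<open>A passage from circles to the disc without polar coordinates: the circle means are
  integrated over \<open>z\<close>, the integrals are swapped, and for each angle rotation
  invariance removes the factor \<open>e t\<close>. The angle then contributes only the length 1 of
  \<open>{0..1}\<close>.\<close>

lemma norm_le_disc_mean:
  assumes v: "v holomorphic_on UNIV"
  shows "ennreal (norm (v \<zeta>)) * emeasure lborel (ball (0::complex) 1) \<le>
    (\<integral>\<^sup>+z. ennreal (norm (v (\<zeta> + z))) * indicator (ball 0 1) z \<partial>lborel)"
proof -
  have "continuous_on UNIV v"
    by (rule holomorphic_on_imp_continuous_on[OF v])
  then have [measurable]: "v \<in> borel_measurable borel"
    by (rule borel_measurable_continuous_onI)
  define e where "e = (\<lambda>t::real. exp (2 * of_real pi * \<i> * of_real t))"
  have [measurable]: "e \<in> borel_measurable borel"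
    unfolding e_def by (intro borel_measurable_continuous_onI continuous_intros)
  have ne: "norm (e t) = 1" for t
    unfolding e_def by (simp add: norm_exp_eq_Re)
  have [measurable]: "ball (0::complex) 1 \<in> sets borel" "{0..1::real} \<in> sets borel"
    by auto
  define F where "F = (\<lambda>t z. ennreal (norm (v (\<zeta> + e t * z))) * indicator {0..1} t * indicator (ball 0 1) z)"
  let ?R = "\<integral>\<^sup>+z. ennreal (norm (v (\<zeta> + z))) * indicator (ball 0 1) z \<partial>lborel"
  have "ennreal (norm (v \<zeta>)) * emeasure lborel (ball (0::complex) 1)
      = (\<integral>\<^sup>+z. ennreal (norm (v \<zeta>)) * indicator (ball 0 1) z \<partial>(lborel :: complex measure))"
    by (subst nn_integral_cmult) auto
  also have "\<dots> \<le> (\<integral>\<^sup>+z. (\<integral>\<^sup>+t. F t z \<partial>lborel) \<partial>lborel)"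
  proof (rule nn_integral_mono)
    fix z :: complex
    have "(\<integral>\<^sup>+t. F t z \<partial>lborel)
        = (\<integral>\<^sup>+t. ennreal (norm (v (\<zeta> + e t * z))) * indicator {0..1} t \<partial>lborel) * indicator (ball 0 1) z"
      unfolding F_def by (subst nn_integral_multc) auto
    then show "ennreal (norm (v \<zeta>)) * indicator (ball 0 1) z \<le> (\<integral>\<^sup>+t. F t z \<partial>lborel)"
      using norm_le_circle_mean[OF v, of \<zeta> z] by (simp add: e_def mult_right_mono)
  qed
  also have "\<dots> = (\<integral>\<^sup>+t. (\<integral>\<^sup>+z. F t z \<partial>lborel) \<partial>lborel)"
    unfolding F_def by (rule lborel_pair.Fubini') simp
  also have "\<dots> = (\<integral>\<^sup>+t. ?R * indicator {0..1} t \<partial>(lborel :: real measure))"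
  proof (rule nn_integral_cong)
    fix t :: real
    \<comment> \<open>The disc is rotation invariant, so its indicator may be evaluated at
      \<open>e t * z\<close>; up to the constant indicator of \<open>t\<close>, the integrand then
      depends on \<open>e t * z\<close> alone.\<close>
    have "(\<integral>\<^sup>+z. F t z \<partial>lborel) = (\<integral>\<^sup>+z. ennreal (norm (v (\<zeta> + e t * z))) * indicator (ball 0 1) (e t * z)
        * indicator {0..1} t \<partial>lborel)"
      unfolding F_def by (intro nn_integral_cong) (simp add: indicator_def norm_mult ne)
    also have "\<dots> = ?R * indicator {0..1} t"
      using nn_integral_lborel_rotate[of "\<lambda>z. ennreal (norm (v (\<zeta> + z))) * indicator (ball 0 1) z" "e t"] ne
      by (subst nn_integral_multc) auto
    finally show "(\<integral>\<^sup>+z. F t z \<partial>lborel) = ?R * indicator {0..1} t" .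
  qed
  also have "\<dots> = ?R"
    by (subst nn_integral_cmult) auto
  finally show ?thesis .
qed

section \<open>Weighted moduli in Fock spaces\<close>

text \<open>Convexity on positive arguments, extended to the endpoint 0. There the claim becomes
  \<open>s powr p \<le> s\<close> for \<open>0 < s < 1\<close>, which is where
  \<open>p \<ge> 1\<close> enters.\<close>

lemma convex_on_powr_nonneg:
  assumes "p \<ge> 1"
  shows "convex_on {0..} (\<lambda>x::real. x powr p)"
proof (rule convex_onI)
  fix t x y :: real
  assume t: "0 < t" "t < 1" and xy: "x \<in> {0..}" "y \<in> {0..}"
  have scale: "(s * z) powr p \<le> s * z powr p" if "0 < s" "s < 1" "0 \<le> z" for s z :: real
  proof -
    have "s powr p \<le> s powr 1"
      using that assms by (intro powr_mono') auto
    then show ?thesis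
      using that by (simp add: powr_mult mult_right_mono)
  qed
  show "((1 - t) *\<^sub>R x + t *\<^sub>R y) powr p \<le> (1 - t) * x powr p + t * y powr p"
  proof (cases "x = 0 \<or> y = 0")
    case True
    then show ?thesis
      using scale[of t y] scale[of "1 - t" x] t xy assms by auto
  next
    case False
    then show ?thesis
      using convex_onD[OF powr_convex[OF assms], of t x y] t xy by simp
  qed
qed simp

text \<open>Jensen's inequality with weights \<open>c i / sum c I\<close>, after the total mass is
  factored out of the sum.\<close>

lemma powr_sum_le:
  fixes c y :: "'i \<Rightarrow> real"
  assumes "finite I" and c: "\<And>i. i \<in> I \<Longrightarrow> 0 \<le> c i" and y: "\<And>i. i \<in> I \<Longrightarrow> 0 \<le> y i"
    and p: "1 \<le> p" and C: "sum c I \<noteq> 0"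
  shows "(\<Sum>i\<in>I. c i * y i) powr p \<le> sum c I powr p * (\<Sum>i\<in>I. c i / sum c I * y i powr p)"
proof -
  let ?C = "sum c I"
  have Cpos: "?C > 0"
    using C c by (simp add: order_less_le sum_nonneg)
  have "(\<Sum>i\<in>I. (c i / ?C) *\<^sub>R y i) powr p \<le> (\<Sum>i\<in>I. c i / ?C * y i powr p)"
  proof (rule convex_on_sum[OF \<open>finite I\<close> _ convex_on_powr_nonneg[OF p]])
    show "I \<noteq> {}" using C by auto
    show "(\<Sum>i\<in>I. c i / ?C) = 1"
      using C by (simp flip: sum_divide_distrib)
  qed (use c y Cpos in auto)
  moreover have "(\<Sum>i\<in>I. c i * y i) = ?C * (\<Sum>i\<in>I. (c i / ?C) *\<^sub>R y i)"
    using C by (simp add: sum_distrib_left)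
  moreover have "0 \<le> (\<Sum>i\<in>I. (c i / ?C) *\<^sub>R y i)"
    using c y Cpos by (intro sum_nonneg) auto
  ultimately show ?thesis
    using Cpos by (simp add: powr_mult mult_left_mono)
qed

text \<open>The \<open>M f z\<close> of the overview. The integral norms and the supremum norm
  depend on \<open>f\<close> only through this function, so pointwise estimates of it serve all
  exponents at once.\<close>

definition fock_mod :: "(complex \<Rightarrow> complex) \<Rightarrow> complex \<Rightarrow> real" where
  "fock_mod f z = norm (f z) * exp (- (norm z)\<^sup>2 / 2)"

lemma fock_mod_nonneg [simp]: "0 \<le> fock_mod f z"
  by (simp add: fock_mod_def)

lemma fock_mod_powr:
  "norm (f z) powr q * exp (- (q * (norm z)\<^sup>2) / 2) = fock_mod f z powr q"
  by (simp add: fock_mod_def powr_mult exp_powr_real algebra_simps)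

lemma borel_measurable_fock_mod [measurable]:
  assumes "f holomorphic_on UNIV"
  shows "fock_mod f \<in> borel_measurable borel"
proof -
  have "continuous_on UNIV (fock_mod f)"
    unfolding fock_mod_def using holomorphic_on_imp_continuous_on[OF assms]
    by (intro continuous_intros) auto
  then show ?thesis
    by (rule borel_measurable_continuous_onI)
qed

text \<open>The \<open>q\<close>-th power of the norm up to the factor \<open>q / (2 * pi)\<close>.
  With values in \<open>ennreal\<close>, energies can be compared before they are known to be
  finite, and membership in the space becomes finiteness.\<close>

definition fock_energy :: "real \<Rightarrow> (complex \<Rightarrow> complex) \<Rightarrow> ennreal" where
  "fock_energy q f = (\<integral>\<^sup>+z. ennreal (fock_mod f z powr q) \<partial>lborel)"

lemma enn2real_ge_1: "1 \<le> p \<Longrightarrow> p \<noteq> \<infinity> \<Longrightarrow> 1 \<le> enn2real p"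
  by (cases p) (auto simp: ennreal_1[symmetric] simp del: ennreal_1)

lemma fock_space_holomorphic: "f \<in> fock_space p \<Longrightarrow> f holomorphic_on UNIV"
  by (simp add: fock_space_def)

lemma fock_space_top:
  "f \<in> fock_space \<infinity> \<longleftrightarrow> f holomorphic_on UNIV \<and> bdd_above (range (fock_mod f))"
  by (simp add: fock_space_def fock_mod_def[abs_def])

lemma fock_norm_top: "fock_norm \<infinity> f = (SUP z. fock_mod f z)"
  by (simp add: fock_norm_def fock_mod_def[abs_def])

lemma fock_space_finite:
  assumes "p \<noteq> \<infinity>"
  shows "f \<in> fock_space p \<longleftrightarrow> f holomorphic_on UNIV \<and> fock_energy (enn2real p) f < \<infinity>"
proof -
  have "integrable lborel (\<lambda>z. fock_mod f z powr enn2real p) \<longleftrightarrow> fock_energy (enn2real p) f < \<infinity>"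
    if [measurable]: "f holomorphic_on UNIV"
    unfolding fock_energy_def by (subst integrable_iff_bounded) auto
  then show ?thesis
    using assms by (simp only: fock_space_def fock_mod_powr if_False mem_Collect_eq) blast
qed

lemma fock_norm_finite:
  assumes "p \<noteq> \<infinity>" and [measurable]: "f holomorphic_on UNIV"
  shows "fock_norm p f =
    (enn2real p / (2 * pi) * enn2real (fock_energy (enn2real p) f)) powr (1 / enn2real p)"
proof -
  have "(LINT z|lborel. fock_mod f z powr enn2real p) = enn2real (fock_energy (enn2real p) f)"
    unfolding fock_energy_def by (rule integral_eq_nn_integral) auto
  then show ?thesis
    using assms(1) by (simp only: fock_norm_def fock_mod_powr if_False)
qed

lemma fock_mod_le_norm_top:
  assumes "f \<in> fock_space \<infinity>"
  shows "fock_mod f z \<le> fock_norm \<infinity> f"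
  using assms unfolding fock_space_top fock_norm_top by (intro cSUP_upper) auto

lemma fock_norm_nonneg:
  assumes "f \<in> fock_space p"
  shows "0 \<le> fock_norm p f"
proof (cases "p = \<infinity>")
  case True
  then show ?thesis
    using fock_mod_le_norm_top[of f 0] assms fock_mod_nonneg[of f 0] by (metis order_trans)
next
  case False
  then show ?thesis
    by (simp add: fock_norm_def)
qed

text \<open>
  Replaces Minkowski's inequality: since the planar isometries preserve the integral, Jensen's
  inequality with weights proportional to \<open>c k\<close> suffices.
\<close>

lemma fock_norm_dominated:
  fixes c :: "'i \<Rightarrow> real" and \<phi> :: "'i \<Rightarrow> complex \<Rightarrow> complex"
  assumes p: "1 \<le> p" and "finite I" and c: "\<And>k. k \<in> I \<Longrightarrow> 0 \<le> c k"
    and \<phi>: "\<And>k. k \<in> I \<Longrightarrow> \<exists>a b. norm a = 1 \<and> \<phi> k = (\<lambda>z. a * z + b)"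
    and f: "f \<in> fock_space p" and g: "g holomorphic_on UNIV"
    and le: "\<And>z. fock_mod g z \<le> (\<Sum>k\<in>I. c k * fock_mod f (\<phi> k z))"
  shows "g \<in> fock_space p" and "fock_norm p g \<le> sum c I * fock_norm p f"
proof -
  have "g \<in> fock_space p \<and> fock_norm p g \<le> sum c I * fock_norm p f"
  proof (cases "p = \<infinity>")
    case True
    have "fock_mod g z \<le> sum c I * fock_norm p f" for z
    proof -
      have "fock_mod f w \<le> fock_norm p f" for w
        using fock_mod_le_norm_top f True by metis
      then have "fock_mod g z \<le> (\<Sum>k\<in>I. c k * fock_norm p f)"
        using c by (intro order_trans[OF le] sum_mono mult_left_mono)
      then show ?thesis
        by (simp add: sum_distrib_right)
    qed
    then show ?thesis
      unfolding True fock_space_top fock_norm_top using g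
      by (intro conjI cSUP_least) (auto simp: bdd_above_def)
  next
    case False
    define q where "q = enn2real p"
    have q: "1 \<le> q"
      unfolding q_def using enn2real_ge_1[OF p False] .
    define C where "C = sum c I"
    have C0: "0 \<le> C"
      unfolding C_def using c by (intro sum_nonneg)
    have fh [measurable]: "f holomorphic_on UNIV"
      using f by (rule fock_space_holomorphic)
    have Ef: "fock_energy q f < \<infinity>"
      using f fock_space_finite[OF False] by (simp add: q_def)
    have iso: "(\<integral>\<^sup>+z. ennreal (fock_mod f (\<phi> k z) powr q) \<partial>lborel) = fock_energy q f"
      and meas: "(\<lambda>z. ennreal (fock_mod f (\<phi> k z) powr q)) \<in> borel_measurable lborel"
      if k: "k \<in> I" for k
    proof -
      obtain a b where ab: "norm a = 1" "\<phi> k = (\<lambda>z. a * z + b)"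
        using \<phi>[OF k] by auto
      show "(\<integral>\<^sup>+z. ennreal (fock_mod f (\<phi> k z) powr q) \<partial>lborel) = fock_energy q f"
        using nn_integral_lborel_isometry[of "\<lambda>z. ennreal (fock_mod f z powr q)" a b] ab
        by (simp add: fock_energy_def)
      show "(\<lambda>z. ennreal (fock_mod f (\<phi> k z) powr q)) \<in> borel_measurable lborel"
        unfolding ab by measurable
    qed
    \<comment> \<open>The Jensen weights \<open>c k / C\<close> require \<open>C \<noteq> 0\<close>;
      for \<open>C = 0\<close> all coefficients vanish, and with them
      \<open>fock_mod g\<close>.\<close>
    have E: "fock_energy q g \<le> ennreal (C powr q) * fock_energy q f"
    proof (cases "C = 0")
      case True
      then have "c k = 0" if "k \<in> I" for k
        using c \<open>finite I\<close> that by (auto simp: C_def sum_nonneg_eq_0_iff)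
      then have "fock_mod g z = 0" for z
        using le[of z] by (simp add: order_antisym)
      then show ?thesis
        by (simp add: fock_energy_def)
    next
      case False
      have "fock_mod g z powr q \<le> C powr q * (\<Sum>k\<in>I. c k / C * fock_mod f (\<phi> k z) powr q)" for z
      proof -
        have "fock_mod g z powr q \<le> (\<Sum>k\<in>I. c k * fock_mod f (\<phi> k z)) powr q"
          using q by (intro powr_mono2 le) auto
        also have "\<dots> \<le> C powr q * (\<Sum>k\<in>I. c k / C * fock_mod f (\<phi> k z) powr q)"
          unfolding C_def using False q c \<open>finite I\<close> by (intro powr_sum_le) (auto simp: C_def)
        finally show ?thesis .
      qed
      then have "fock_energy q g \<le> (\<integral>\<^sup>+z. ennreal (C powr q * (\<Sum>k\<in>I. c k / C * fock_mod f (\<phi> k z) powr q)) \<partial>lborel)"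
        unfolding fock_energy_def by (intro nn_integral_mono ennreal_leI)
      also have "\<dots> = (\<integral>\<^sup>+z. ennreal (C powr q) * (\<Sum>k\<in>I. ennreal (c k / C) * ennreal (fock_mod f (\<phi> k z) powr q)) \<partial>lborel)"
      proof (rule nn_integral_cong)
        fix z
        have "(\<Sum>k\<in>I. ennreal (c k / C) * ennreal (fock_mod f (\<phi> k z) powr q))
            = (\<Sum>k\<in>I. ennreal (c k / C * fock_mod f (\<phi> k z) powr q))"
          using c C0 by (intro sum.cong refl ennreal_mult[symmetric]) auto
        also have "\<dots> = ennreal (\<Sum>k\<in>I. c k / C * fock_mod f (\<phi> k z) powr q)"
          using c C0 by (intro sum_ennreal) auto
        finally show "ennreal (C powr q * (\<Sum>k\<in>I. c k / C * fock_mod f (\<phi> k z) powr q))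
            = ennreal (C powr q) * (\<Sum>k\<in>I. ennreal (c k / C) * ennreal (fock_mod f (\<phi> k z) powr q))"
          by (simp add: ennreal_mult')
      qed
      also have "\<dots> = ennreal (C powr q) * (\<Sum>k\<in>I. ennreal (c k / C) * fock_energy q f)"
      proof -
        have m: "(\<lambda>z. ennreal (c k / C) * ennreal (fock_mod f (\<phi> k z) powr q)) \<in> borel_measurable lborel"
          if "k \<in> I" for k
          using meas[OF that] by measurable
        have "(\<integral>\<^sup>+z. (\<Sum>k\<in>I. ennreal (c k / C) * ennreal (fock_mod f (\<phi> k z) powr q)) \<partial>lborel)
            = (\<Sum>k\<in>I. \<integral>\<^sup>+z. ennreal (c k / C) * ennreal (fock_mod f (\<phi> k z) powr q) \<partial>lborel)"
          using m by (rule nn_integral_sum)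
        also have "\<dots> = (\<Sum>k\<in>I. ennreal (c k / C) * fock_energy q f)"
          by (intro sum.cong refl) (simp only: nn_integral_cmult[OF meas] iso)
        finally show ?thesis
          using m by (subst nn_integral_cmult) (auto intro!: borel_measurable_sum)
      qed
      also have "(\<Sum>k\<in>I. ennreal (c k / C) * fock_energy q f) = fock_energy q f"
      proof -
        have "(\<Sum>k\<in>I. ennreal (c k / C)) = ennreal (\<Sum>k\<in>I. c k / C)"
          using c C0 by (intro sum_ennreal) auto
        also have "(\<Sum>k\<in>I. c k / C) = 1"
          using False by (simp add: C_def flip: sum_divide_distrib)
        finally show ?thesis
          by (simp only: sum_distrib_right[symmetric] ennreal_1 mult_1)
      qed
      finally show ?thesis .
    qed
    have fin: "ennreal (C powr q) * fock_energy q f < \<infinity>"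
      using Ef by (simp add: ennreal_mult_less_top)
    then have "g \<in> fock_space p"
      using E g fock_space_finite[OF False] by (auto simp: q_def)
    moreover have "fock_norm p g \<le> C * fock_norm p f"
    proof -
      define X where "X = q / (2 * pi) * enn2real (fock_energy q f)"
      have X: "0 \<le> X"
        using q by (simp add: X_def)
      have "enn2real (fock_energy q g) \<le> C powr q * enn2real (fock_energy q f)"
        using enn2real_mono[OF E] fin by (simp add: enn2real_mult)
      then have "q / (2 * pi) * enn2real (fock_energy q g)
          \<le> q / (2 * pi) * (C powr q * enn2real (fock_energy q f))"
        using q by (intro mult_left_mono) auto
      then have "q / (2 * pi) * enn2real (fock_energy q g) \<le> C powr q * X"
        by (simp only: X_def mult.left_commute)
      then have "fock_norm p g \<le> (C powr q * X) powr (1 / q)"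
        unfolding fock_norm_finite[OF False g] q_def[symmetric] using q
        by (intro powr_mono2) auto
      also have "\<dots> = C * X powr (1 / q)"
        using q C0 X by (simp add: powr_mult powr_powr)
      also have "X powr (1 / q) = fock_norm p f"
        unfolding fock_norm_finite[OF False fh] q_def[symmetric] X_def ..
      finally show ?thesis .
    qed
    ultimately show ?thesis
      by (simp add: C_def)
  qed
  then show "g \<in> fock_space p" and "fock_norm p g \<le> sum c I * fock_norm p f"
    by auto
qed

section \<open>Normalised reproducing kernels\<close>

text \<open>Where \<open>n \<le> norm z < n + 1\<close>, the Gaussian is at most
  \<open>exp (- s * n)\<close>, because \<open>n \<le> n\<^sup>2 \<le> (norm z)\<^sup>2\<close>.
  Summing these bounds over the full discs of radius \<open>n + 1\<close> gives a convergent series,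
  as the disc areas grow only quadratically.\<close>

lemma nn_integral_gaussian_finite:
  fixes s :: real
  assumes s: "s > 0"
  shows "(\<integral>\<^sup>+z. ennreal (exp (- s * (norm z)\<^sup>2)) \<partial>(lborel :: complex measure)) < \<infinity>"
proof -
  define h :: "nat \<Rightarrow> complex \<Rightarrow> ennreal"
    where "h = (\<lambda>n z. ennreal (exp (- s * real n)) * indicator (ball 0 (real (Suc n))) z)"
  have [measurable]: "h n \<in> borel_measurable lborel" for n
    unfolding h_def by (intro borel_measurable_times_ennreal borel_measurable_indicator) auto
  have le: "ennreal (exp (- s * (norm z)\<^sup>2)) \<le> (\<Sum>n. h n z)" for z
  proof -
    define n where "n = nat \<lfloor>norm z\<rfloor>"
    have n: "real n \<le> norm z" "norm z < real (Suc n)"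
      unfolding n_def by (auto simp: of_nat_nat floor_le_iff) linarith
    have "real n \<le> (real n)\<^sup>2"
      by (cases n) (auto simp: power2_eq_square)
    also have "\<dots> \<le> (norm z)\<^sup>2"
      using n by (intro power_mono) auto
    finally have "ennreal (exp (- s * (norm z)\<^sup>2)) \<le> h n z"
      using n s by (auto simp: h_def intro!: ennreal_leI)
    also have "\<dots> \<le> (\<Sum>n. h n z)"
      using sum_le_suminf[of "\<lambda>n. h n z" "{n}"] by simp
    finally show ?thesis .
  qed
  have summ: "summable (\<lambda>n. exp (- s * real n) * (pi * (real (Suc n))\<^sup>2))"
  proof (rule summable_comparison_test_bigo)
    \<comment> \<open>Half of the exponential decay is given up to absorb the quadratic growth of
      the areas.\<close>
    have "summable (\<lambda>n. exp (- s / 2) ^ n)"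
      using s by (intro summable_geometric) auto
    then show "summable (\<lambda>n. norm (exp (- s / 2) ^ n))"
      by simp
    show "(\<lambda>n. exp (- s * real n) * (pi * (real (Suc n))\<^sup>2)) \<in> O(\<lambda>n. exp (- s / 2) ^ n)"
      using s by real_asymp
  qed
  have "(\<integral>\<^sup>+z. ennreal (exp (- s * (norm z)\<^sup>2)) \<partial>(lborel :: complex measure))
      \<le> (\<integral>\<^sup>+z. (\<Sum>n. h n z) \<partial>lborel)"
    by (intro nn_integral_mono le)
  also have "\<dots> = (\<Sum>n. \<integral>\<^sup>+z. h n z \<partial>lborel)"
    by (rule nn_integral_suminf) simp
  also have "\<dots> = (\<Sum>n. ennreal (exp (- s * real n) * (pi * (real (Suc n))\<^sup>2)))"
  proof (rule suminf_cong)
    fix n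
    have "(\<integral>\<^sup>+z. h n z \<partial>lborel)
        = ennreal (exp (- s * real n)) * emeasure lborel (ball (0::complex) (real (Suc n)))"
      unfolding h_def by (rule nn_integral_cmult_indicator) auto
    also have "\<dots> = ennreal (exp (- s * real n)) * ennreal (pi * (real (Suc n))\<^sup>2)"
      by (subst emeasure_ball) (auto simp: unit_ball_vol_2)
    finally show "(\<integral>\<^sup>+z. h n z \<partial>lborel) = ennreal (exp (- s * real n) * (pi * (real (Suc n))\<^sup>2))"
      by (simp only: ennreal_mult' exp_ge_zero)
  qed
  also have "\<dots> = ennreal (\<Sum>n. exp (- s * real n) * (pi * (real (Suc n))\<^sup>2))"
    using summ by (intro suminf_ennreal2) auto
  also have "\<dots> < \<infinity>"
    by simp
  finally show ?thesis .
qed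

text \<open>The model for all normalised kernels, whose weighted moduli are translates of that of
  the constant 1. It also makes the index set of the supremum in \<open>fock_onorm\<close>
  nonempty.\<close>

lemma fock_space_one:
  assumes "1 \<le> p"
  shows "(\<lambda>_. 1) \<in> fock_space p"
proof (cases "p = \<infinity>")
  case True
  show ?thesis
    unfolding True fock_space_top by (auto simp: fock_mod_def intro!: bdd_aboveI2[where M = 1])
next
  case False
  define q where "q = enn2real p"
  have q: "1 \<le> q"
    unfolding q_def using enn2real_ge_1[OF assms False] .
  have "fock_mod (\<lambda>_. 1) z powr q = exp (- (q / 2) * (norm z)\<^sup>2)" for z
    using fock_mod_powr[of "\<lambda>_. 1" z q] by simp
  then show ?thesis
    using nn_integral_gaussian_finite[of "q / 2"] q
    unfolding fock_space_finite[OF False] fock_energy_def q_def[symmetric] by simp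
qed

text \<open>The reproducing kernel \<open>exp (cnj w * z)\<close> of the Hilbert space case
  \<open>p = 2\<close>, divided by its norm \<open>exp ((norm w)\<^sup>2 / 2)\<close>.\<close>

definition fock_kernel :: "complex \<Rightarrow> complex \<Rightarrow> complex" where
  "fock_kernel w z = exp (cnj w * z - of_real ((norm w)\<^sup>2 / 2))"

text \<open>Completing the square. The result is a translated Gaussian, which is why the kernels are
  bounded uniformly in \<open>w\<close> for every exponent.\<close>

lemma fock_mod_kernel: "fock_mod (fock_kernel w) z = exp (- (norm (z - w))\<^sup>2 / 2)"
proof -
  have "Re (cnj w * z) - (norm w)\<^sup>2 / 2 + - (norm z)\<^sup>2 / 2 = - (norm (z - w))\<^sup>2 / 2"
    unfolding cmod_power2 by (simp add: power2_eq_square field_simps)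
  then show ?thesis
    by (simp add: fock_mod_def fock_kernel_def norm_exp_eq_Re flip: exp_add)
qed

lemma fock_kernel_holomorphic: "fock_kernel w holomorphic_on UNIV"
  unfolding fock_kernel_def[abs_def] by (intro holomorphic_intros)

lemma fock_kernel_in_space:
  assumes p: "1 \<le> p"
  shows "fock_kernel w \<in> fock_space p"
    and "fock_norm p (fock_kernel w) \<le> fock_norm p (\<lambda>_. 1)"
proof -
  \<comment> \<open>Domination is applied with a one-point index set: a single translation with
    coefficient 1.\<close>
  have "\<exists>a b. norm a = 1 \<and> (\<lambda>z. z - w) = (\<lambda>z. a * z + b)"
    by (rule exI[of _ 1], rule exI[of _ "- w"]) auto
  moreover have "fock_mod (fock_kernel w) z \<le> (\<Sum>k\<in>{()}. 1 * fock_mod (\<lambda>_. 1) (z - w))" for z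
    by (simp add: fock_mod_kernel) (simp add: fock_mod_def)
  ultimately show "fock_kernel w \<in> fock_space p"
    and "fock_norm p (fock_kernel w) \<le> fock_norm p (\<lambda>_. 1)"
    using fock_norm_dominated[OF p, of "{()}" "\<lambda>_. 1" "\<lambda>_ z. z - w", OF _ _ _ fock_space_one[OF p]
        fock_kernel_holomorphic, of w]
    by auto
qed

section \<open>Rigidity of the weight of a bounded operator\<close>

lemma fock_mod_weighted_comp_affine:
  assumes a: "norm a = 1"
  shows "fock_mod (weighted_comp u (\<lambda>z. a * z + b) g) z =
    norm (u z * exp (a * cnj b * z)) * exp ((norm b)\<^sup>2 / 2) * fock_mod g (a * z + b)"
proof -
  \<comment> \<open>The cross term is the real part of a linear function of \<open>z\<close>, so its
    exponential is the modulus of an entire function and can be merged with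
    \<open>u\<close>.\<close>
  have "(norm (a * z + b))\<^sup>2 = (norm (a * z))\<^sup>2 + (norm b)\<^sup>2 + 2 * Re ((a * z) * cnj b)"
    unfolding cmod_power2 by (simp add: power2_eq_square algebra_simps)
  then have "- (norm z)\<^sup>2 / 2 = Re (a * cnj b * z) + (norm b)\<^sup>2 / 2 + - (norm (a * z + b))\<^sup>2 / 2"
    using a by (simp add: norm_mult algebra_simps)
  then have "exp (- (norm z)\<^sup>2 / 2)
      = norm (exp (a * cnj b * z)) * exp ((norm b)\<^sup>2 / 2) * exp (- (norm (a * z + b))\<^sup>2 / 2)"
    unfolding norm_exp_eq_Re by (simp only: exp_add)
  then show ?thesis
    by (simp add: fock_mod_def weighted_comp_def norm_mult)
qed

lemma fock_energy_le_norm: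
  assumes "1 \<le> p" "p \<noteq> \<infinity>" "f \<in> fock_space p" "fock_norm p f \<le> K"
  shows "fock_energy (enn2real p) f \<le> ennreal (2 * pi / enn2real p * K powr enn2real p)"
proof -
  define q where "q = enn2real p"
  define E where "E = enn2real (fock_energy q f)"
  have q: "1 \<le> q"
    unfolding q_def using enn2real_ge_1 assms by simp
  have f: "f holomorphic_on UNIV" "fock_energy q f < \<infinity>"
    using assms fock_space_finite by (auto simp: q_def)
  have E0: "0 \<le> q / (2 * pi) * E"
    using q by (simp add: E_def)
  have "(q / (2 * pi) * E) powr (1 / q) \<le> K"
    using assms fock_norm_finite[OF _ f(1)] by (simp add: q_def E_def)
  then have "((q / (2 * pi) * E) powr (1 / q)) powr q \<le> K powr q"
    using q by (intro powr_mono2) auto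
  moreover have "((q / (2 * pi) * E) powr (1 / q)) powr q = q / (2 * pi) * E"
    using q E0 by (simp add: powr_powr E_def)
  ultimately have "q / (2 * pi) * E \<le> K powr q"
    by (simp only:)
  then have "E \<le> 2 * pi / q * K powr q"
    using q by (simp add: field_simps)
  moreover have "fock_energy q f = ennreal E"
    using f by (simp add: E_def)
  ultimately show ?thesis
    unfolding q_def[symmetric] by (simp add: ennreal_leI)
qed

text \<open>For \<open>p = \<infinity>\<close> it suffices to evaluate at the centre
  \<open>\<zeta>\<close>. For finite \<open>p\<close> the Gaussian is bounded below on the unit disc
  around \<open>\<zeta>\<close>, so the norm of \<open>g \<zeta>\<close> controls the integral of
  \<open>v\<close> there, and the disc mean inequality bounds \<open>v \<zeta>\<close> uniformly in
  \<open>\<zeta>\<close>.\<close>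

lemma bounded_multiplier_of_kernel_bound:
  assumes p: "1 \<le> p" and v: "v holomorphic_on UNIV"
    and g: "\<And>\<zeta>. g \<zeta> \<in> fock_space p" "\<And>\<zeta>. fock_norm p (g \<zeta>) \<le> K"
    and mod: "\<And>\<zeta> z. fock_mod (g \<zeta>) z = norm (v z) * exp (- (norm (z - \<zeta>))\<^sup>2 / 2)"
  shows "bounded (range v)"
proof (cases "p = \<infinity>")
  case True
  have "norm (v \<zeta>) \<le> K" for \<zeta>
    using fock_mod_le_norm_top[of "g \<zeta>" \<zeta>] g[of \<zeta>] mod[of \<zeta> \<zeta>] True by simp
  then show ?thesis
    by (auto simp: bounded_iff)
next
  case False
  define q where "q = enn2real p"
  have q: "1 \<le> q"
    unfolding q_def using enn2real_ge_1[OF p False] .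
  define L where "L = 2 * pi / q * K powr q"
  have L0: "0 \<le> L"
    using q by (simp add: L_def)
  have [measurable]: "g \<zeta> holomorphic_on UNIV" for \<zeta>
    using g(1) by (rule fock_space_holomorphic)
  have [measurable]: "ball (0::complex) 1 \<in> sets borel"
    by auto
  have "norm (v \<zeta>) * pi \<le> pi + exp (q / 2) * L" for \<zeta>
  proof -
    have pointwise: "ennreal (norm (v (\<zeta> + z))) * indicator (ball 0 1) z
        \<le> indicator (ball 0 1) z + ennreal (exp (q / 2)) * ennreal (fock_mod (g \<zeta>) (\<zeta> + z) powr q)" for z
    proof (cases "z \<in> ball 0 1")
      case z: True
      define y where "y = norm (v (\<zeta> + z))"
      have y0: "0 \<le> y"
        by (simp add: y_def)
      \<comment> \<open>This trades the \<open>q\<close>-th power for the first, so that the mean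
        value inequality for \<open>norm v\<close> suffices.\<close>
      have "y \<le> 1 + y powr q"
      proof (cases "y \<le> 1")
        case False
        then have "y powr 1 \<le> y powr q"
          using q by (intro powr_mono) auto
        then show ?thesis
          using False by simp
      qed (simp add: add_increasing2)
      \<comment> \<open>On the unit disc the \<open>q\<close>-th power of the Gaussian is at least
        \<open>exp (- q / 2)\<close>; the constant compensates for it.\<close>
      also have "y powr q \<le> exp (q / 2) * fock_mod (g \<zeta>) (\<zeta> + z) powr q"
      proof -
        have "(norm z)\<^sup>2 \<le> 1"
          using z by (simp add: power_le_one)
        then have "q * (norm z)\<^sup>2 \<le> q"
          using q by (simp add: mult_left_le)
        then have "1 \<le> exp (q / 2) * exp (- (norm z)\<^sup>2 / 2) powr q"
          by (simp add: exp_powr_real algebra_simps flip: exp_add)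
        then have "y powr q * 1 \<le> y powr q * (exp (q / 2) * exp (- (norm z)\<^sup>2 / 2) powr q)"
          by (intro mult_left_mono) auto
        then show ?thesis
          using y0 by (simp add: mod y_def[symmetric] powr_mult mult_ac)
      qed
      finally have "ennreal y \<le> ennreal (1 + exp (q / 2) * fock_mod (g \<zeta>) (\<zeta> + z) powr q)"
        by (intro ennreal_leI) auto
      then show ?thesis
        using z by (simp add: y_def ennreal_plus ennreal_mult)
    qed simp
    have "ennreal (norm (v \<zeta>) * pi) = ennreal (norm (v \<zeta>)) * emeasure lborel (ball (0::complex) 1)"
      by (simp add: emeasure_ball unit_ball_vol_2 ennreal_mult)
    also have "\<dots> \<le> (\<integral>\<^sup>+z. ennreal (norm (v (\<zeta> + z))) * indicator (ball 0 1) z \<partial>lborel)"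
      by (rule norm_le_disc_mean[OF v])
    also have "\<dots> \<le> (\<integral>\<^sup>+z. indicator (ball 0 1) z
        + ennreal (exp (q / 2)) * ennreal (fock_mod (g \<zeta>) (\<zeta> + z) powr q) \<partial>lborel)"
      by (intro nn_integral_mono pointwise)
    also have "\<dots> = emeasure lborel (ball (0::complex) 1)
        + ennreal (exp (q / 2)) * (\<integral>\<^sup>+z. ennreal (fock_mod (g \<zeta>) (\<zeta> + z) powr q) \<partial>lborel)"
      by (subst nn_integral_add) (auto simp: nn_integral_cmult)
    also have "(\<integral>\<^sup>+z. ennreal (fock_mod (g \<zeta>) (\<zeta> + z) powr q) \<partial>lborel) = fock_energy q (g \<zeta>)"
      unfolding fock_energy_def by (rule nn_integral_lborel_translate) simp
    also have "emeasure lborel (ball (0::complex) 1) + ennreal (exp (q / 2)) * fock_energy q (g \<zeta>)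
        \<le> ennreal pi + ennreal (exp (q / 2)) * ennreal L"
      using fock_energy_le_norm[OF p False g] unfolding L_def q_def
      by (intro add_mono mult_left_mono) (auto simp: emeasure_ball unit_ball_vol_2)
    also have "\<dots> = ennreal (pi + exp (q / 2) * L)"
      using L0 by (simp add: ennreal_plus ennreal_mult)
    finally show ?thesis
      using L0 by (subst (asm) ennreal_le_iff) auto
  qed
  then have "norm (v \<zeta>) \<le> (pi + exp (q / 2) * L) / pi" for \<zeta>
    by (simp add: pos_le_divide_eq)
  then show ?thesis
    by (auto simp: bounded_iff)
qed

text \<open>The value at 0 identifies the constant supplied by Liouville. For \<open>b = 0\<close>
  the weight \<open>u\<close> itself is constant, which the periodic case relies on.\<close>

lemma weight_of_bounded_affine_comp:
  assumes p: "1 \<le> p" and u: "u holomorphic_on UNIV" and a: "norm a = 1"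
    and bdd: "fock_bounded_op p (weighted_comp u (\<lambda>z. a * z + b))"
  shows "u z * exp (a * cnj b * z) = u 0"
proof -
  let ?W = "weighted_comp u (\<lambda>z. a * z + b)"
  \<comment> \<open>The positive constant from the modulus formula is absorbed here, so that
    \<open>v\<close> is exactly the multiplier in front of the Gaussian.\<close>
  define v where "v = (\<lambda>z. of_real (exp ((norm b)\<^sup>2 / 2)) * (u z * exp (a * cnj b * z)))"
  obtain C where C: "fock_norm p (?W f) \<le> C * fock_norm p f" if "f \<in> fock_space p" for f
    using bdd unfolding fock_bounded_op_def by blast
  \<comment> \<open>The kernel sits at the image of \<open>\<zeta>\<close>, so that after
    composition with the affine isometry its Gaussian is centred at \<open>\<zeta>\<close>.\<close>
  define g where "g = (\<lambda>\<zeta>. ?W (fock_kernel (a * \<zeta> + b)))"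
  have holv: "v holomorphic_on UNIV"
    unfolding v_def using u by (intro holomorphic_intros)
  have "bounded (range v)"
  proof (rule bounded_multiplier_of_kernel_bound[OF p holv])
    fix \<zeta>
    note k = fock_kernel_in_space[OF p, of "a * \<zeta> + b"]
    show "g \<zeta> \<in> fock_space p"
      using bdd k unfolding g_def fock_bounded_op_def by auto
    have "fock_norm p (g \<zeta>) \<le> C * fock_norm p (fock_kernel (a * \<zeta> + b))"
      unfolding g_def by (rule C[OF k(1)])
    \<comment> \<open>The bound \<open>C\<close> comes without a sign, hence the absolute
      value.\<close>
    also have "\<dots> \<le> \<bar>C\<bar> * fock_norm p (\<lambda>_. 1)"
      using k fock_norm_nonneg[OF k(1)] by (intro mult_mono) auto
    finally show "fock_norm p (g \<zeta>) \<le> \<bar>C\<bar> * fock_norm p (\<lambda>_. 1)" .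
    fix z
    have "norm (a * z + b - (a * \<zeta> + b)) = norm (z - \<zeta>)"
      using a by (metis add_diff_cancel_right mult_1 norm_mult right_diff_distrib)
    then show "fock_mod (g \<zeta>) z = norm (v z) * exp (- (norm (z - \<zeta>))\<^sup>2 / 2)"
      unfolding g_def fock_mod_weighted_comp_affine[OF a] fock_mod_kernel v_def
      by (simp add: norm_mult)
  qed
  then have "v constant_on UNIV"
    by (rule Liouville_theorem[OF holv])
  then have "v z = v 0"
    by (auto simp: constant_on_def)
  then show ?thesis
    by (simp add: v_def)
qed

section \<open>Linear combinations of iterates\<close>

text \<open>The uniform bound makes the set of quotients bounded above, so the real supremum
  dominates the nonnegative quotient of the constant 1. A vanishing denominator yields the quotient
  0, which is at most \<open>C\<close> as \<open>0 \<le> C\<close>.\<close>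

lemma fock_onorm_bounds:
  assumes p: "1 \<le> p" and T: "\<And>f. f \<in> fock_space p \<Longrightarrow> T f \<in> fock_space p"
    and le: "\<And>f. f \<in> fock_space p \<Longrightarrow> fock_norm p (T f) \<le> C * fock_norm p f" and C: "0 \<le> C"
  shows "0 \<le> fock_onorm p T" and "fock_onorm p T \<le> C"
proof -
  have ratio: "0 \<le> fock_norm p (T f) / fock_norm p f" "fock_norm p (T f) / fock_norm p f \<le> C"
    if f: "f \<in> fock_space p" for f
    using fock_norm_nonneg[OF f] fock_norm_nonneg[OF T[OF f]] le[OF f] C
    by (auto simp: divide_le_eq)
  have one: "(\<lambda>_. 1) \<in> fock_space p"
    by (rule fock_space_one[OF p])
  show "fock_onorm p T \<le> C"
    unfolding fock_onorm_def using one ratio by (intro cSUP_least) auto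
  have "bdd_above ((\<lambda>f. fock_norm p (T f) / fock_norm p f) ` fock_space p)"
    using ratio(2) by (rule bdd_aboveI2)
  from cSUP_upper[OF one this] ratio(1)[OF one] show "0 \<le> fock_onorm p T"
    unfolding fock_onorm_def by (rule order_trans[rotated])
qed

lemma funpow_affine:
  fixes a b :: complex
  assumes "norm a = 1"
  shows "\<exists>a' b'. norm a' = 1 \<and> (\<lambda>z. a * z + b) ^^ k = (\<lambda>z. a' * z + b')"
proof (induction k)
  case 0
  show ?case
    by (rule exI[of _ 1], rule exI[of _ 0]) auto
next
  case (Suc k)
  then obtain a' b' where "norm a' = 1" "(\<lambda>z. a * z + b) ^^ k = (\<lambda>z. a' * z + b')"
    by auto
  then show ?case
    using assms by (intro exI[of _ "a * a'"] exI[of _ "a * b' + b"]) (auto simp: norm_mult algebra_simps)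
qed

text \<open>Isolates the one consequence of boundedness that the ergodic arguments use; the cases
  \<open>r < 1\<close> and \<open>r = 1\<close> are both derived from it.\<close>

locale scaled_fock_isometry =
  fixes p :: ennreal and u :: "complex \<Rightarrow> complex" and a b :: complex and r :: real
  assumes p: "1 \<le> p" and u: "u holomorphic_on UNIV" and a: "norm a = 1" and r: "0 \<le> r"
    and fock_mod_weighted_comp: "fock_mod (weighted_comp u (\<lambda>z. a * z + b) f) z = r * fock_mod f (a * z + b)"
begin

abbreviation W :: fun_operator where
  "W \<equiv> weighted_comp u (\<lambda>z. a * z + b)"

lemma fock_mod_iterate: "fock_mod ((W ^^ k) f) z = r ^ k * fock_mod f (((\<lambda>z. a * z + b) ^^ k) z)"
proof (induction k arbitrary: z)
  case (Suc k)
  then show ?case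
    by (simp add: fock_mod_weighted_comp funpow_swap1[of "\<lambda>z. a * z + b"])
qed simp

lemma iterate_holomorphic: "f holomorphic_on UNIV \<Longrightarrow> (W ^^ k) f holomorphic_on UNIV"
proof (induction k)
  case (Suc k)
  have "(\<lambda>z. (W ^^ k) f (a * z + b)) holomorphic_on UNIV"
    by (intro holomorphic_on_compose_gen[OF _ Suc.IH[OF Suc.prems], unfolded o_def] holomorphic_intros) auto
  then show ?case
    using u by (simp add: weighted_comp_def[abs_def] holomorphic_intros)
qed simp

lemma iterate_linear:
  "(W ^^ k) (\<lambda>z. f z + g z) = (\<lambda>z. (W ^^ k) f z + (W ^^ k) g z)"
  "(W ^^ k) (\<lambda>z. c * f z) = (\<lambda>z. c * (W ^^ k) f z)"
  by (induction k) (simp_all add: weighted_comp_def[abs_def] algebra_simps)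

text \<open>The pointwise triangle inequality and the modulus formula for iterates give a domination
  with coefficients \<open>norm (d k) * r ^ k\<close>. The means, their limits and, for
  \<open>n > 0\<close>, the differences between them all have this form.\<close>

lemma combination_bound:
  assumes "finite I" and f: "f \<in> fock_space p"
  shows "(\<lambda>z. \<Sum>k\<in>I. d k * (W ^^ k) f z) \<in> fock_space p"
    and "fock_norm p (\<lambda>z. \<Sum>k\<in>I. d k * (W ^^ k) f z) \<le> (\<Sum>k\<in>I. norm (d k) * r ^ k) * fock_norm p f"
proof -
  have fh: "f holomorphic_on UNIV"
    using f by (rule fock_space_holomorphic)
  have hol: "(\<lambda>z. \<Sum>k\<in>I. d k * (W ^^ k) f z) holomorphic_on UNIV"
    by (intro holomorphic_intros iterate_holomorphic[OF fh])
  have le: "fock_mod (\<lambda>z. \<Sum>k\<in>I. d k * (W ^^ k) f z) z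
      \<le> (\<Sum>k\<in>I. norm (d k) * r ^ k * fock_mod f (((\<lambda>z. a * z + b) ^^ k) z))" for z
  proof -
    have "fock_mod (\<lambda>z. \<Sum>k\<in>I. d k * (W ^^ k) f z) z \<le> (\<Sum>k\<in>I. norm (d k) * fock_mod ((W ^^ k) f) z)"
      unfolding fock_mod_def mult.assoc[symmetric] sum_distrib_right[symmetric] norm_mult[symmetric]
      by (intro mult_right_mono norm_sum) auto
    then show ?thesis
      by (simp add: fock_mod_iterate mult.assoc)
  qed
  show "(\<lambda>z. \<Sum>k\<in>I. d k * (W ^^ k) f z) \<in> fock_space p"
    by (rule fock_norm_dominated(1)[OF p \<open>finite I\<close> _ funpow_affine[OF a] f hol le]) (simp add: r)
  show "fock_norm p (\<lambda>z. \<Sum>k\<in>I. d k * (W ^^ k) f z) \<le> (\<Sum>k\<in>I. norm (d k) * r ^ k) * fock_norm p f"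
    by (rule fock_norm_dominated(2)[OF p \<open>finite I\<close> _ funpow_affine[OF a] f hol le]) (simp add: r)
qed

lemma combination_bounded_op:
  assumes "finite I"
  shows "fock_bounded_op p (\<lambda>f z. \<Sum>k\<in>I. d k * (W ^^ k) f z)"
proof -
  have "\<exists>C. \<forall>f\<in>fock_space p. fock_norm p (\<lambda>z. \<Sum>k\<in>I. d k * (W ^^ k) f z) \<le> C * fock_norm p f"
    using combination_bound(2)[OF assms] by blast
  moreover have "(\<lambda>z. \<Sum>k\<in>I. d k * (W ^^ k) (\<lambda>z. f z + g z) z)
      = (\<lambda>z. (\<Sum>k\<in>I. d k * (W ^^ k) f z) + (\<Sum>k\<in>I. d k * (W ^^ k) g z))" for f g
    by (simp only: iterate_linear distrib_left sum.distrib)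
  moreover have "(\<lambda>z. \<Sum>k\<in>I. d k * (W ^^ k) (\<lambda>z. c * f z) z)
      = (\<lambda>z. c * (\<Sum>k\<in>I. d k * (W ^^ k) f z))" for c f
    by (simp only: iterate_linear sum_distrib_left mult.left_commute)
  ultimately show ?thesis
    unfolding fock_bounded_op_def using combination_bound(1)[OF assms] by blast
qed

lemma combination_onorm:
  assumes "finite I"
  shows "0 \<le> fock_onorm p (\<lambda>f z. \<Sum>k\<in>I. d k * (W ^^ k) f z)"
    and "fock_onorm p (\<lambda>f z. \<Sum>k\<in>I. d k * (W ^^ k) f z) \<le> (\<Sum>k\<in>I. norm (d k) * r ^ k)"
proof -
  have nonneg: "0 \<le> (\<Sum>k\<in>I. norm (d k) * r ^ k)"
    using r by (intro sum_nonneg) auto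
  note bounds = fock_onorm_bounds[where T = "\<lambda>f z. \<Sum>k\<in>I. d k * (W ^^ k) f z",
      OF p combination_bound[OF assms] nonneg]
  show "0 \<le> fock_onorm p (\<lambda>f z. \<Sum>k\<in>I. d k * (W ^^ k) f z)"
    by (rule bounds(1))
  show "fock_onorm p (\<lambda>f z. \<Sum>k\<in>I. d k * (W ^^ k) f z) \<le> (\<Sum>k\<in>I. norm (d k) * r ^ k)"
    by (rule bounds(2))
qed

text \<open>The geometric series bounds the sums by \<open>1 / (1 - r)\<close> whatever
  \<open>I n\<close> is, and the factor \<open>1 / n\<close> does the rest. General index sets cover
  both the means starting at \<open>m = 1\<close> and the sums starting at
  \<open>k = 0\<close>.\<close>

lemma mean_onorm_tendsto_0:
  fixes I :: "nat \<Rightarrow> nat set"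
  assumes r1: "r < 1" and fin: "\<And>n. finite (I n)"
  shows "(\<lambda>n. fock_onorm p (\<lambda>f z. (1 / of_nat n) * (\<Sum>k\<in>I n. (W ^^ k) f z))) \<longlonglongrightarrow> 0"
proof (rule tendsto_sandwich[OF always_eventually always_eventually tendsto_const]; (intro allI)?)
  fix n
  have eq: "(\<lambda>f z. (1 / of_nat n) * (\<Sum>k\<in>I n. (W ^^ k) f z))
      = (\<lambda>f z. \<Sum>k\<in>I n. (1 / of_nat n) * (W ^^ k) f z)"
    by (simp only: sum_distrib_left)
  show "0 \<le> fock_onorm p (\<lambda>f z. (1 / of_nat n) * (\<Sum>k\<in>I n. (W ^^ k) f z))"
    unfolding eq by (rule combination_onorm(1)[OF fin])
  have "(\<Sum>k\<in>I n. r ^ k) \<le> (\<Sum>k. r ^ k)"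
    using r r1 by (intro sum_le_suminf fin summable_geometric) auto
  also have "\<dots> = 1 / (1 - r)"
    using r r1 by (intro suminf_geometric) auto
  finally have geom: "(\<Sum>k\<in>I n. r ^ k) \<le> 1 / (1 - r)" .
  \<comment> \<open>With \<open>1 / 0 = 0\<close> the estimate holds at \<open>n = 0\<close> as
    well.\<close>
  have "(\<Sum>k\<in>I n. norm (1 / of_nat n :: complex) * r ^ k) = 1 / real n * (\<Sum>k\<in>I n. r ^ k)"
    by (simp only: sum_distrib_left norm_divide norm_one norm_of_nat)
  also have "\<dots> \<le> 1 / real n * (1 / (1 - r))"
    by (intro mult_left_mono geom) auto
  finally show "fock_onorm p (\<lambda>f z. (1 / of_nat n) * (\<Sum>k\<in>I n. (W ^^ k) f z))
      \<le> 1 / real n * (1 / (1 - r))"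
    unfolding eq using combination_onorm(2)[OF fin] by (rule order_trans[rotated])
next
  show "(\<lambda>n. 1 / real n * (1 / (1 - r))) \<longlonglongrightarrow> 0"
    by (intro tendsto_mult_left_zero lim_1_over_n)
qed

lemma uniformly_mean_ergodic_of_contraction:
  assumes "r < 1" and W: "fock_bounded_op p W"
  shows "uniformly_mean_ergodic p W"
proof -
  \<comment> \<open>The limit is the zero operator, seen as an empty combination of
    iterates.\<close>
  have "fock_bounded_op p (\<lambda>f z. 0)"
    using combination_bounded_op[of "{}"] by simp
  moreover have "(\<lambda>n. fock_onorm p (\<lambda>f z. (1 / of_nat n) * (\<Sum>m=1..n. (W ^^ m) f z) - 0)) \<longlonglongrightarrow> 0"
    using mean_onorm_tendsto_0[OF \<open>r < 1\<close>, of "\<lambda>n. {1..n}"] by simp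
  ultimately show ?thesis
    unfolding uniformly_mean_ergodic_def using W by blast
qed

text \<open>
  When \<open>W\<close> has period \<open>N\<close>, so has the \<open>n\<close>-th partial sum minus \<open>n\<close> times the average over one
  period, which is therefore bounded in \<open>n\<close>.
\<close>

lemma uniformly_mean_ergodic_of_periodic:
  assumes W: "fock_bounded_op p W" and r1: "r = 1" and N: "N \<ge> 1"
    and period: "\<And>f. (W ^^ N) f = f"
  shows "uniformly_mean_ergodic p W"
proof -
  \<comment> \<open>The period is taken as \<open>{1..N}\<close> to match the means, which start at
    1.\<close>
  define P :: fun_operator where "P = (\<lambda>f z. \<Sum>k\<in>{1..N}. (1 / of_nat N) * (W ^^ k) f z)"
  \<comment> \<open>For \<open>n > 0\<close> these are the coefficients of the \<open>n\<close>-th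
    mean minus \<open>P\<close>: full periods cancel, the first \<open>n mod N\<close> iterates
    remain, and \<open>n mod N\<close> copies of the average are subtracted.\<close>
  define d :: "nat \<Rightarrow> nat \<Rightarrow> complex" where
    "d = (\<lambda>n k. (1 / of_nat n) * ((if k \<le> n mod N then 1 else 0) - of_nat (n mod N) / of_nat N))"
  have iter: "(W ^^ (m + N)) f = (W ^^ m) f" for m f
    by (simp add: funpow_add period)
  have D: "(\<Sum>m=1..n. (W ^^ m) f z) - of_nat n * P f z
      = (\<Sum>m=1..n mod N. (W ^^ m) f z) - of_nat (n mod N) * P f z" for n f z
  proof (induction n rule: less_induct)
    case (less n)
    show ?case
    proof (cases "n < N")
      case True
      then show ?thesis by simp
    next
      case False
      then obtain m where m: "n = m + N"
        by (metis add.commute le_iff_add not_le)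
      define x where "x = (\<lambda>j. (W ^^ j) f z)"
      have "(\<Sum>j=1..N + m. x j) = (\<Sum>j=1..N. x j) + (\<Sum>j=N+1..N + m. x j)"
        by (rule sum.ub_add_nat) simp
      also have "(\<Sum>j=N+1..N + m. x j) = (\<Sum>j=1..m. x (j + N))"
        using sum.shift_bounds_cl_nat_ivl[of x 1 N m] by (simp add: add.commute)
      also have "\<dots> = (\<Sum>j=1..m. x j)"
        by (simp only: x_def iter)
      also have "(\<Sum>j=1..N. x j) = of_nat N * P f z"
        using N by (simp add: P_def x_def sum_distrib_left)
      finally have "(\<Sum>j=1..n. x j) - of_nat n * P f z = (\<Sum>j=1..m. x j) - of_nat m * P f z"
        by (simp add: m add.commute[of N] distrib_right)
      then show ?thesis
        using less.IH[of m] N by (simp add: m x_def)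
    qed
  qed
  have diff: "(1 / of_nat n) * (\<Sum>m=1..n. (W ^^ m) f z) - P f z = (\<Sum>k\<in>{1..N}. d n k * (W ^^ k) f z)"
    if n: "n > 0" for n f z
  proof -
    let ?s = "n mod N"
    have s: "?s \<le> N"
      using N by (simp add: less_imp_le)
    have "(1 / of_nat n) * (\<Sum>m=1..n. (W ^^ m) f z) - P f z
        = (1 / of_nat n) * ((\<Sum>m=1..n. (W ^^ m) f z) - of_nat n * P f z)"
      using n by (simp add: algebra_simps)
    also have "\<dots> = (1 / of_nat n) * ((\<Sum>m=1..?s. (W ^^ m) f z) - of_nat ?s * P f z)"
      by (simp only: D[where n = n and f = f and z = z])
    also have "(\<Sum>m=1..?s. (W ^^ m) f z) = (\<Sum>m=1..N. if m \<le> ?s then (W ^^ m) f z else 0)"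
      using s by (intro sum.mono_neutral_cong_left) auto
    also have "(1 / of_nat n) * ((\<Sum>m=1..N. if m \<le> ?s then (W ^^ m) f z else 0) - of_nat ?s * P f z)
        = (\<Sum>k\<in>{1..N}. d n k * (W ^^ k) f z)"
      unfolding P_def d_def sum_distrib_left sum_subtractf[symmetric]
      by (intro sum.cong refl) (simp add: algebra_simps)
    finally show ?thesis .
  qed
  have dle: "norm (d n k) \<le> 1 / real n" for n k
  proof -
    have "0 \<le> real (n mod N) / real N" "real (n mod N) / real N \<le> 1"
      using N by (auto simp: divide_le_eq less_imp_le)
    then have "\<bar>(if k \<le> n mod N then 1 else 0) - real (n mod N) / real N\<bar> \<le> 1"
      by auto
    moreover have "d n k = of_real (1 / real n * ((if k \<le> n mod N then 1 else 0) - real (n mod N) / real N))"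
      by (simp add: d_def)
    ultimately show ?thesis
      by (simp only: norm_of_real abs_mult) (simp add: divide_right_mono)
  qed
  have "(\<lambda>n. fock_onorm p (\<lambda>f z. \<Sum>k\<in>{1..N}. d n k * (W ^^ k) f z)) \<longlonglongrightarrow> 0"
  proof (rule tendsto_sandwich[OF always_eventually always_eventually tendsto_const]; (intro allI)?)
    fix n
    show "0 \<le> fock_onorm p (\<lambda>f z. \<Sum>k\<in>{1..N}. d n k * (W ^^ k) f z)"
      by (rule combination_onorm(1)) simp
    have "(\<Sum>k\<in>{1..N}. norm (d n k) * r ^ k) \<le> (\<Sum>k\<in>{1..N}. 1 / real n)"
      using dle r1 by (intro sum_mono) simp
    then show "fock_onorm p (\<lambda>f z. \<Sum>k\<in>{1..N}. d n k * (W ^^ k) f z) \<le> real N * (1 / real n)"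
      using combination_onorm(2)[of "{1..N}" "d n"] by simp
  next
    show "(\<lambda>n. real N * (1 / real n)) \<longlonglongrightarrow> 0"
      by (intro tendsto_mult_right_zero lim_1_over_n)
  qed
  \<comment> \<open>Equality is claimed only for \<open>n > 0\<close>: at \<open>n = 0\<close> the
    mean is 0 and the difference would be \<open>- P\<close>, while
    \<open>d 0 k = 0\<close>.\<close>
  moreover have "eventually (\<lambda>n. fock_onorm p (\<lambda>f z. \<Sum>k\<in>{1..N}. d n k * (W ^^ k) f z)
      = fock_onorm p (\<lambda>f z. (1 / of_nat n) * (\<Sum>m=1..n. (W ^^ m) f z) - P f z)) sequentially"
    using eventually_gt_at_top[of 0] by eventually_elim (simp only: diff)
  ultimately have "(\<lambda>n. fock_onorm p (\<lambda>f z. (1 / of_nat n) * (\<Sum>m=1..n. (W ^^ m) f z) - P f z)) \<longlonglongrightarrow> 0"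
    by (rule Lim_transform_eventually)
  moreover have "fock_bounded_op p P"
    unfolding P_def by (rule combination_bounded_op) simp
  ultimately show ?thesis
    unfolding uniformly_mean_ergodic_def using W by blast
qed

end

section \<open>The two cases of the theorem\<close>

lemma scaled_fock_isometry_of_bounded:
  assumes p: "1 \<le> p" and u: "u holomorphic_on UNIV" and a: "norm a = 1"
    and bdd: "fock_bounded_op p (weighted_comp u (\<lambda>z. a * z + b))"
  shows "scaled_fock_isometry p u a b (norm (u 0) * exp ((norm b)\<^sup>2 / 2))"
proof
  show "fock_mod (weighted_comp u (\<lambda>z. a * z + b) f) z
      = norm (u 0) * exp ((norm b)\<^sup>2 / 2) * fock_mod f (a * z + b)" for f z
    unfolding fock_mod_weighted_comp_affine[OF a] weight_of_bounded_affine_comp[OF assms] ..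
qed (use assms in auto)

lemma weighted_rotation_iterate:
  "(weighted_comp (\<lambda>_. c) (\<lambda>z. a * z) ^^ k) f = (\<lambda>z. c ^ k * f (a ^ k * z))"
  by (induction k) (simp_all add: weighted_comp_def fun_eq_iff mult_ac)

theorem theorem4p4:
  fixes p :: ennreal and u \<psi> :: "complex \<Rightarrow> complex"
  assumes "1 \<le> p"
    and "u holomorphic_on UNIV" and "\<psi> holomorphic_on UNIV"
    and "fock_bounded_op p (weighted_comp u \<psi>)"
  shows "(\<forall>a b. (\<forall>z. \<psi> z = a * z + b) \<and> norm a = 1 \<and> norm (u 0) < exp (- (norm b)\<^sup>2 / 2) \<longrightarrow>
            uniformly_mean_ergodic p (weighted_comp u \<psi>) \<and>
            (\<lambda>n. fock_onorm p
                (\<lambda>f z. (1 / of_nat n) * (\<Sum>k=0..n. (weighted_comp u \<psi> ^^ k) f z)))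
              \<longlonglongrightarrow> 0)
       \<and> (\<forall>a. (\<forall>z. \<psi> z = a * z) \<and> norm a = 1 \<and> root_of_unity (u 0) \<and> root_of_unity a \<longrightarrow>
            uniformly_mean_ergodic p (weighted_comp u \<psi>))"
proof (intro conjI allI impI; (elim conjE)?)
  fix a b :: complex
  assume \<psi>: "\<forall>z. \<psi> z = a * z + b" and a: "norm a = 1" and small: "norm (u 0) < exp (- (norm b)\<^sup>2 / 2)"
  have \<psi>_eq: "\<psi> = (\<lambda>z. a * z + b)"
    using \<psi> by auto
  interpret scaled_fock_isometry p u a b "norm (u 0) * exp ((norm b)\<^sup>2 / 2)"
    using assms a by (intro scaled_fock_isometry_of_bounded) (auto simp: \<psi>_eq)
  have r1: "norm (u 0) * exp ((norm b)\<^sup>2 / 2) < 1"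
    using small by (simp add: exp_minus field_simps)
  show "uniformly_mean_ergodic p (weighted_comp u \<psi>)"
    using uniformly_mean_ergodic_of_contraction[OF r1] assms by (simp add: \<psi>_eq)
  show "(\<lambda>n. fock_onorm p (\<lambda>f z. (1 / of_nat n) * (\<Sum>k=0..n. (weighted_comp u \<psi> ^^ k) f z)))
      \<longlonglongrightarrow> 0"
    using mean_onorm_tendsto_0[OF r1, of "\<lambda>n. {0..n}"] by (simp add: \<psi>_eq)
next
  fix a :: complex
  assume \<psi>: "\<forall>z. \<psi> z = a * z" and a: "norm a = 1"
    and roots: "root_of_unity (u 0)" "root_of_unity a"
  \<comment> \<open>The summand 0 is kept so that the map has the affine shape of the locale with
    \<open>b = 0\<close>.\<close>
  have \<psi>_eq: "\<psi> = (\<lambda>z. a * z + 0)"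
    using \<psi> by auto
  have bdd: "fock_bounded_op p (weighted_comp u (\<lambda>z. a * z + 0))"
    using assms \<psi>_eq by simp
  interpret scaled_fock_isometry p u a 0 "norm (u 0) * exp ((norm (0::complex))\<^sup>2 / 2)"
    using assms a bdd by (intro scaled_fock_isometry_of_bounded)
  obtain j k :: nat where j: "j \<ge> 1" "u 0 ^ j = 1" and k: "k \<ge> 1" "a ^ k = 1"
    using roots by (auto simp: root_of_unity_def)
  have "norm (u 0) ^ j = 1"
    using j by (metis norm_one norm_power)
  then have "norm (u 0) = 1"
    using j power_eq_iff_eq_base[of j "norm (u 0)" 1] by simp
  then have r1: "norm (u 0) * exp ((norm (0::complex))\<^sup>2 / 2) = 1"
    by simp
  have "u z = u 0" for z
    using weight_of_bounded_affine_comp[OF assms(1,2) a bdd, of z] by simp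
  then have u_eq: "u = (\<lambda>_. u 0)"
    by (rule ext)
  \<comment> \<open>\<open>j * k\<close> is a common period of the scalar \<open>u 0\<close> and the
    rotation by \<open>a\<close>.\<close>
  have "u 0 ^ (j * k) = 1"
    using j by (simp add: power_mult)
  moreover have "a ^ (j * k) = 1"
    using k by (simp add: mult.commute[of j] power_mult)
  ultimately have "(weighted_comp u (\<lambda>z. a * z + 0) ^^ (j * k)) f = f" for f
    by (subst u_eq) (simp add: weighted_rotation_iterate)
  then show "uniformly_mean_ergodic p (weighted_comp u \<psi>)"
    using uniformly_mean_ergodic_of_periodic[OF bdd r1, of "j * k"] j k by (simp add: \<psi>_eq)
qed

end
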